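(* For every $n\ge 1$, \[ F_{21}(n;q)=(1-q)^{n+1}\sum_{j\ge1}(j-1)\,j^{n-1}q^{j-2}=\frac{1}{q}\Bigl(A_n(q)+(q-1)A_{n-1}(q)\Bigr). \] Moreover, \[ \sum_{n\ge0}F_{21}(n+1;q)\frac{x^n}{n!}=\frac{(1-q)^2}{\bigl(e^{(q-1)x}-q\bigr)^2}=A(x,q)^2 . \]
   Context: Let $\mathcal S_n$ be the set of permutations of $[n]=\{1,\dots,n\}$. Write $\pi\in\mathcal S_n$ in standard cycle form: each cycle is written starting with its smallest element, and cycles are arranged from left to right in increasing order of their smallest elements. $\mathrm{Flatten}(\pi)$ is the word (permutation of length $n$) obtained by erasing the parentheses; e.g. $(172)(3546)(8)$ gives $17235468$. A descent of a word $w_1\cdots w_n$ is an index $i\in[n-1]$ with $w_i>w_{i+1}$; $\mathrm{des}(w)$ is the number of descents. Define $F_{21}(n;q)=\sum_{\pi\in\mathcal S_n}q^{\mathrm{des}(\mathrm{Flatten}(\pi))}$. The Eulerian polynomial is $A_n(q)=\sum_{k=0}^nA_{n,k}q^k$, where $A_{n,k}$ is the number of permutations of length $n$ with exactly $k$ ascents (indices $i$ with $w_i<w_{i+1}$), with $A_0(q)=1$; equivalently $A_n(q)=(1-q)^{n+1}\sum_{j\ge1}j^nq^{j-1}$ as power series in $q$. Its exponential generating function is $A(x,q)=\sum_{n\ge0}A_n(q)x^n/n!=\frac{1-q}{e^{(q-1)x}-q}$. The infinite sum over $j$ is understood as a power series in $q$. *)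

theory Defs
  imports
    "HOL-Combinatorics.Combinatorics"
    "HOL-Computational_Algebra.Computational_Algebra"
    "HOL-Analysis.Infinite_Sum"
begin

definition des :: "nat list \<Rightarrow> nat" where
  "des w = card {i. Suc i < length w \<and> w ! i > w ! Suc i}"

definition asc :: "nat list \<Rightarrow> nat" where
  "asc w = card {i. Suc i < length w \<and> w ! i < w ! Suc i}"

text \<open>
  \<^const>\<open>support\<close> \<open>\<pi> i\<close> is the list \<open>[i, \<pi> i, \<pi> (\<pi> i), \<dots>]\<close> running once through the cycle
  of \<open>i\<close>. Fixed points yield cycles of length one, so every element of \<open>{1..n}\<close> is listed.
\<close>

definition cycle_minima :: "nat \<Rightarrow> (nat \<Rightarrow> nat) \<Rightarrow> nat set" where
  "cycle_minima n \<pi> = {i \<in> {1..n}. \<forall>j \<in> set (support \<pi> i). i \<le> j}"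

definition standard_cycle_form :: "nat \<Rightarrow> (nat \<Rightarrow> nat) \<Rightarrow> nat list list" where
  "standard_cycle_form n \<pi> = map (support \<pi>) (sorted_list_of_set (cycle_minima n \<pi>))"

definition Flatten :: "nat \<Rightarrow> (nat \<Rightarrow> nat) \<Rightarrow> nat list" where
  "Flatten n \<pi> = concat (standard_cycle_form n \<pi>)"

definition F21 :: "nat \<Rightarrow> rat poly" where
  "F21 n = (\<Sum>\<pi> | \<pi> permutes {1..n}. monom 1 (des (Flatten n \<pi>)))"

definition eulerian_number :: "nat \<Rightarrow> nat \<Rightarrow> nat" where
  "eulerian_number n k = card {w \<in> permutations_of_set {1..n}. asc w = k}"

definition eulerian_poly :: "nat \<Rightarrow> rat poly" where
  "eulerian_poly n = (\<Sum>k = 0..n. monom (of_nat (eulerian_number n k)) k)"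

text \<open>
  Identities in \<open>q\<close> are stated in the field of formal Laurent series in \<open>q\<close>, into which polynomials
  and power series in \<open>q\<close> embed. There \<open>1/q\<close> is a genuine inverse, and infinite sums are taken
  in the \<open>q\<close>-adic topology, the metric that the library puts on \<^typ>\<open>rat fls\<close>.
\<close>

abbreviation q :: "rat fls" where
  "q \<equiv> fls_X"

definition in_q :: "rat poly \<Rightarrow> rat fls" where
  "in_q p = fps_to_fls (fps_of_poly p)"

text \<open>The outer formal power series is in the variable \<open>x\<close>.\<close>

definition egf :: "(nat \<Rightarrow> rat poly) \<Rightarrow> rat fls fps" where
  "egf f = Abs_fps (\<lambda>n. in_q (f n) / fact n)"

end

theory Submission
  imports Defs
begin

text \<open>
  Inserting the maximum \<open>n + 1\<close> into a word \<open>w\<close> of length \<open>n\<close> with \<open>d\<close> descents keeps the number of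
  descents at each descent and at the end, and raises it by one at each ascent and at the front.
  A permutation of \<open>[n + 1]\<close> arises from one of \<open>[n]\<close> by putting \<open>n + 1\<close> behind some \<open>i\<close> in the cycle
  of \<open>i\<close>, or as a fixed point; in the flattened word every position except the front is used once,
  and the end twice. This gives
  \<open>F\<^sub>n\<^sub>+\<^sub>1 = (2 + (n - 1) q) F\<^sub>n + q (1 - q) F\<^sub>n'\<close>, and for words in general
  \<open>A\<^sub>n\<^sub>+\<^sub>1 = (1 + n q) A\<^sub>n + q (1 - q) A\<^sub>n'\<close>. The power series on the right of the theorem satisfy the same
  recurrences. Comparing coefficients of the series yields \<open>q F\<^sub>n = A\<^sub>n + (q - 1) A\<^sub>n\<^sub>-\<^sub>1\<close>, and
  the binomial theorem yields \<open>A(x, q) (e\<^bsup>(q-1)x\<^esup> - q) = 1 - q\<close>; differentiating the latter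
  in \<open>x\<close> turns the former into the statement on \<open>A(x, q)\<^sup>2\<close>.
\<close>

subsection \<open>Descents and insertion of a maximum\<close>

lemma des_Nil [simp]: "des [] = 0"
  by (simp add: des_def)

lemma des_single [simp]: "des [x] = 0"
  by (simp add: des_def)

lemma des_Cons_Cons: "des (x # y # w) = (if x > y then 1 else 0) + des (y # w)"
proof -
  let ?D = "{i. Suc i < length (y # w) \<and> (y # w) ! i > (y # w) ! Suc i}"
  have "{i. Suc i < length (x # y # w) \<and> (x # y # w) ! i > (x # y # w) ! Suc i} =
      (if x > y then {0} else {}) \<union> Suc ` ?D"
    (is "?L = ?R")
  proof (rule set_eqI)
    fix i show "i \<in> ?L \<longleftrightarrow> i \<in> ?R"
      by (cases i) (auto simp: image_iff)
  qed
  moreover have "finite ?D"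
    by (rule finite_subset[of _ "{..<length (y # w)}"]) auto
  ultimately show ?thesis
    unfolding des_def by (simp add: card_image card_insert_if)
qed

lemma des_append_greater:
  assumes "\<And>x. x \<in> set w \<Longrightarrow> x < m"
  shows "des (w @ [m]) = des w"
  using assms
proof (induction w)
  case (Cons x w)
  then show ?case by (cases w) (auto simp: des_Cons_Cons)
qed simp

lemma des_Cons_greater:
  assumes "\<And>x. x \<in> set w \<Longrightarrow> x < m" and "w \<noteq> []"
  shows "des (m # w) = Suc (des w)"
  using assms by (cases w) (auto simp: des_Cons_Cons)

text \<open>With \<open>l = length w\<close>, reversal carries positions \<open>i\<close>,
  \<open>i + 1\<close> to \<open>l - 1 - i\<close>, \<open>l - 2 - i\<close>, so the index map is
  its own inverse.\<close>

lemma asc_eq_des_rev: "asc w = des (rev w)"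
proof -
  have "bij_betw (\<lambda>i. length w - 2 - i)
     {i. Suc i < length w \<and> w ! i < w ! Suc i}
     {i. Suc i < length (rev w) \<and> rev w ! i > rev w ! Suc i}"
    by (rule bij_betw_byWitness[where f' = "\<lambda>i. length w - 2 - i"])
       (auto simp: rev_nth Suc_diff_Suc numeral_2_eq_2)
  then show ?thesis
    unfolding asc_def des_def by (rule bij_betw_same_card)
qed

abbreviation X :: "rat poly" where
  "X \<equiv> [:0, 1:]"

lemma pderiv_sum: "pderiv (\<Sum>i\<in>I. f i) = (\<Sum>i\<in>I. pderiv (f i))"
  by (induction I rule: infinite_finite_induct) (simp_all add: pderiv_add)

text \<open>Only the slots behind a letter are summed. With \<open>d = des w\<close>, the end and
  the \<open>d\<close> descents contribute \<open>P\<close> each, the other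
  \<open>length w - 1 - d\<close> gaps \<open>X * P\<close> each. As
  \<open>X * pderiv P = of_nat d * P\<close>, the derivative expresses \<open>d\<close> in a form
  linear in \<open>P\<close>, which can later be summed over words.\<close>

lemma sum_des_insert_max:
  assumes "w \<noteq> []" and "\<And>x. x \<in> set w \<Longrightarrow> x < m"
  defines "P \<equiv> monom 1 (des w) :: rat poly"
  shows "(\<Sum>k<length w. monom 1 (des (take (Suc k) w @ m # drop (Suc k) w))) =
    P + of_nat (length w - 1) * X * P + X * (1 - X) * pderiv P"
  using assms(1,2) unfolding P_def
proof (induction w rule: induct_list012)
  case (2 x)
  then show ?case by (simp add: des_Cons_Cons)
next
  case (3 x y w)
  define P where "P = (monom 1 (des (y # w)) :: rat poly)"
  define e where "e = (if x > y then X else 1)"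
  have mX: "monom 1 (Suc d) = X * (monom 1 d :: rat poly)" for d
    by (simp add: monom_Suc)
  have IH: "(\<Sum>k<length (y # w). monom 1 (des (take (Suc k) (y # w) @ m # drop (Suc k) (y # w)))) =
    P + of_nat (length w) * X * P + X * (1 - X) * pderiv P"
    using 3 by (auto simp: P_def)
  \<comment> \<open>Passing from \<open>x\<close> up to \<open>m\<close> and down to
    \<open>y\<close> gives exactly one descent, however \<open>x\<close> and \<open>y\<close>
    compare.\<close>
  have des0: "monom 1 (des (x # m # y # w)) = X * P"
    using 3(4)[of x] 3(4)[of y] by (simp add: des_Cons_Cons P_def monom_Suc)
  have desS: "monom 1 (des (x # y # v)) = e * (monom 1 (des (y # v)) :: rat poly)" for v
    by (simp add: des_Cons_Cons e_def monom_Suc)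
  have "(\<Sum>k<length (x # y # w). monom 1 (des (take (Suc k) (x # y # w) @ m # drop (Suc k) (x # y # w)))) =
     X * P + e * (\<Sum>k<length (y # w). monom 1 (des (take (Suc k) (y # w) @ m # drop (Suc k) (y # w))))"
    unfolding length_Cons[of x] sum.lessThan_Suc_shift
    by (simp add: des0 desS sum_distrib_left del: sum.lessThan_Suc)
  also have "\<dots> = X * P + e * (P + of_nat (length w) * X * P + X * (1 - X) * pderiv P)"
    by (simp only: IH)
  \<comment> \<open>For \<open>e = 1\<close> the new term \<open>X * P\<close> raises the
    coefficient by one. For \<open>e = X\<close> the product rule adds
    \<open>X * (1 - X) * P\<close>, which together with the new \<open>X * (X * P)\<close> makes
    \<open>X * P\<close>.\<close>
  also have "\<dots> = e * P + of_nat (Suc (length w)) * X * (e * P) + X * (1 - X) * pderiv (e * P)"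
  proof (cases "x > y")
    case True
    have "pderiv X = 1" by (simp add: pderiv_pCons)
    then have "pderiv (X * P) = X * pderiv P + P"
      by (simp only: pderiv_mult mult_1_right)
    with True show ?thesis
      unfolding e_def by (simp only: if_True of_nat_Suc) (simp only: algebra_simps)
  next
    case False
    then show ?thesis unfolding e_def
      by (simp only: if_False of_nat_Suc) (simp only: algebra_simps mult_1_left)
  qed
  finally show ?case
    by (simp add: desS P_def)
qed simp

subsection \<open>Insertion into a cycle\<close>

lemma successively_nth_Suc:
  "successively R xs \<Longrightarrow> Suc k < length xs \<Longrightarrow> R (xs ! k) (xs ! Suc k)"
  by (simp add: successively_conv_nth)

text \<open>Turns orbits into list reasoning: the powers of \<open>f\<close> run through
  \<open>xs\<close>, and distinctness rules out a return to the head before \<open>length xs\<close>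
  steps.\<close>

lemma support_eqI:
  assumes "xs \<noteq> []" and "distinct xs"
    and succ: "successively (\<lambda>a b. f a = b) xs" and last: "f (last xs) = hd xs"
  shows "support f (hd xs) = xs"
proof -
  have pow: "(f ^^ k) (hd xs) = xs ! k" if "k < length xs" for k
    using that
  proof (induction k)
    case 0
    then show ?case using assms(1) by (simp add: hd_conv_nth)
  next
    case (Suc k)
    then show ?case using successively_nth_Suc[OF succ, of k] by simp
  qed
  have "least_power f (hd xs) = length xs"
    unfolding least_power_def
  proof (rule Least_equality)
    obtain l where l: "length xs = Suc l"
      using assms(1) by (cases xs) auto
    then have "f ((f ^^ l) (hd xs)) = hd xs"
      using last pow[of l] assms(1) by (simp add: last_conv_nth)
    then show "(f ^^ length xs) (hd xs) = hd xs \<and> length xs > 0"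
      using l by simp
  next
    fix k assume k: "(f ^^ k) (hd xs) = hd xs \<and> k > 0"
    show "length xs \<le> k"
    proof (rule ccontr)
      assume "\<not> length xs \<le> k"
      then have "xs ! k = xs ! 0"
        using pow[of k] k assms(1) by (simp add: hd_conv_nth)
      then show False
        using \<open>\<not> length xs \<le> k\<close> k assms(1,2) by (simp add: nth_eq_iff_index_eq)
    qed
  qed
  then show ?thesis
    using pow by (auto intro: nth_equalityI)
qed

text \<open>A converse to \<open>support_eqI\<close>, up to distinctness, which
  \<open>cycle_of_permutation\<close> supplies.\<close>

lemma support_cyclic:
  assumes "permutation p"
  shows "support p a \<noteq> []" and "hd (support p a) = a"
    and "successively (\<lambda>x y. p x = y) (support p a)" and "p (last (support p a)) = a"
proof -
  note lp = least_power_of_permutation[OF assms, of a]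
  show ne: "support p a \<noteq> []" using lp by simp
  show "hd (support p a) = a" using lp by (simp add: hd_map hd_upt)
  show "successively (\<lambda>x y. p x = y) (support p a)"
    by (simp add: successively_conv_nth)
  obtain l where l: "least_power p a = Suc l" using lp(2) by (cases "least_power p a") auto
  have "last (support p a) = (p ^^ l) a" by (simp add: l)
  then show "p (last (support p a)) = a" using lp(1) l by simp
qed

text \<open>Acting letter by letter makes it distribute over append and \<open>concat\<close>, hence
  over the cycles of a flattened permutation.\<close>

definition insert_after :: "'a \<Rightarrow> 'a \<Rightarrow> 'a list \<Rightarrow> 'a list" where
  "insert_after i m xs = concat (map (\<lambda>x. if x = i then [x, m] else [x]) xs)"

lemma insert_after_append [simp]:
  "insert_after i m (xs @ ys) = insert_after i m xs @ insert_after i m ys"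
  by (simp add: insert_after_def)

lemma insert_after_Cons:
  "insert_after i m (x # xs) = (if x = i then [x, m] else [x]) @ insert_after i m xs"
  by (simp add: insert_after_def)

lemma insert_after_notin [simp]: "i \<notin> set xs \<Longrightarrow> insert_after i m xs = xs"
  by (induction xs) (auto simp: insert_after_Cons insert_after_def)

lemma insert_after_concat:
  "insert_after i m (concat xss) = concat (map (insert_after i m) xss)"
  by (induction xss) (simp_all add: insert_after_def)

lemma set_insert_after:
  "set (insert_after i m xs) = (if i \<in> set xs then insert m (set xs) else set xs)"
  by (induction xs) (auto simp: insert_after_Cons insert_after_def)

text \<open>Translates insertion behind a letter, which suits cycles, into insertion at a position,
  which suits descents.\<close>

lemma insert_after_nth:
  assumes "distinct w" and "k < length w"
  shows "insert_after (w ! k) m w = take (Suc k) w @ m # drop (Suc k) w"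
proof -
  have w: "w = take k w @ w ! k # drop (Suc k) w"
    by (rule id_take_nth_drop[OF assms(2)])
  then have "distinct (take k w @ w ! k # drop (Suc k) w)"
    using assms(1) by simp
  then have "insert_after (w ! k) m (take k w @ w ! k # drop (Suc k) w) =
      take k w @ w ! k # m # drop (Suc k) w"
    by (simp add: insert_after_Cons del: append_take_drop_id)
  then show ?thesis
    using w assms(2) by (simp add: take_Suc_conv_app_nth)
qed

text \<open>The composite sends \<open>i\<close> to \<open>m\<close> and \<open>m\<close> to
  \<open>p i\<close> and otherwise agrees with \<open>p\<close>, so it splices the fixed point
  \<open>m\<close> into the cycle of \<open>i\<close>.\<close>

lemma support_comp_transpose:
  assumes "permutation p" and "p m = m" and "i \<noteq> m" and "j \<noteq> m"
  shows "support (p \<circ> transpose i m) j = insert_after i m (support p j)"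
proof -
  define xs where "xs = support p j"
  define f where "f = p \<circ> transpose i m"
  have xs: "xs \<noteq> []" "hd xs = j" "distinct xs" "successively (\<lambda>x y. p x = y) xs" "p (last xs) = j"
    using support_cyclic[OF assms(1), of j] cycle_of_permutation[OF assms(1), of j]
    unfolding xs_def by blast+
  \<comment> \<open>A fixed point of \<open>p\<close> lies on no orbit but its own.\<close>
  have m: "m \<notin> set xs"
  proof
    assume "m \<in> set xs"
    then obtain k where k: "(p ^^ k) j = m" by (auto simp: xs_def)
    have km: "(p ^^ k) m = m"
      using assms(2) by (induction k) auto
    have "inj (p ^^ k)"
      using assms(1) by (intro inj_fn bij_is_inj permutation_bijective)
    from injD[OF this, of j m] show False
      using \<open>j \<noteq> m\<close> k km by simp
  qed
  have fx: "f x = p x" if "x \<noteq> i" "x \<noteq> m" for x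
    using that by (simp add: f_def)
  have fi: "f i = m" and fm: "f m = p i"
    using assms(2) by (simp_all add: f_def)
  have mono: "successively (\<lambda>x y. f x = y) zs"
    if "successively (\<lambda>x y. p x = y) zs" "set zs \<subseteq> set xs - {i}" for zs
    using that(1) by (rule successively_mono) (use that(2) m in \<open>metis fx DiffE insertI1 subsetD\<close>)
  have "support f (hd (insert_after i m xs)) = insert_after i m xs"
  proof (cases "i \<in> set xs")
    case False
    have "successively (\<lambda>x y. f x = y) xs"
      using xs(4) False by (intro mono) auto
    moreover have "f (last xs) = hd xs"
      using xs False m last_in_set[OF xs(1)] by (metis fx)
    ultimately show ?thesis
      using xs False support_eqI[of xs f] by simp
  next
    case True
    then obtain us vs where split: "xs = us @ i # vs" by (meson split_list)
    with xs(3) have notin: "i \<notin> set us" "i \<notin> set vs" by auto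
    have ins: "insert_after i m xs = us @ i # m # vs"
      using notin by (simp add: split insert_after_Cons)
    \<comment> \<open>On \<open>us\<close> and \<open>vs\<close> the maps \<open>f\<close> and
      \<open>p\<close> agree, so only the joints around \<open>i\<close> and \<open>m\<close> and
      the closing step remain.\<close>
    have us: "successively (\<lambda>x y. f x = y) us" and vs: "successively (\<lambda>x y. f x = y) vs"
      using xs(4) notin by (auto simp: split successively_append_iff successively_Cons intro!: mono)
    show ?thesis unfolding ins
    proof (rule support_eqI)
      show "distinct (us @ i # m # vs)" using xs(3) m by (auto simp: split)
      have "f (last us) = i" if "us \<noteq> []"
      proof -
        have "last us \<noteq> i" "last us \<noteq> m"
          using last_in_set[OF that] notin m by (auto simp: split)
        then show ?thesis
          using xs(4) that by (auto simp: fx split successively_append_iff)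
      qed
      moreover have "vs \<noteq> [] \<Longrightarrow> f m = hd vs"
        using xs(4) by (auto simp: split successively_append_iff successively_Cons fm)
      ultimately show "successively (\<lambda>x y. f x = y) (us @ i # m # vs)"
        using us vs fi by (auto simp: successively_append_iff successively_Cons)
      have "vs \<noteq> [] \<Longrightarrow> f (last vs) = p (last vs)"
        using last_in_set[of vs] notin m by (auto simp: split intro!: fx)
      \<comment> \<open>If \<open>vs\<close> is empty, the last letters of the two lists are
        \<open>m\<close> and \<open>i\<close>, and \<open>f m = p i\<close>.\<close>
      then have "f (last (us @ i # m # vs)) = p (last xs)"
        by (auto simp: split fm)
      then show "f (last (us @ i # m # vs)) = hd (us @ i # m # vs)"
        using xs(2,5) by (cases us) (auto simp: split)
    qed simp
  qed
  moreover have "hd (insert_after i m xs) = j"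
    using xs(1,2) by (cases xs) (auto simp: insert_after_Cons)
  ultimately show ?thesis
    by (simp add: xs_def f_def del: map_map)
qed

lemma support_fixpoint: "p m = m \<Longrightarrow> support p m = [m]"
  using support_eqI[of "[m]" p] by simp

text \<open>Being the largest element, \<open>Suc n\<close> neither becomes a cycle minimum nor
  changes one when it enters the cycle of \<open>i\<close>. The order of the cycles therefore
  persists.\<close>

lemma
  assumes "p permutes {1..n}" and "i \<in> {1..n}"
  defines "\<sigma> \<equiv> p \<circ> transpose i (Suc n)"
  shows cycle_minima_comp_transpose: "cycle_minima (Suc n) \<sigma> = cycle_minima n p"
    and Flatten_comp_transpose: "Flatten (Suc n) \<sigma> = insert_after i (Suc n) (Flatten n p)"
proof -
  have perm: "permutation p" and fixed: "p (Suc n) = Suc n"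
    using assms(1) by (auto simp: permutation_permutes intro: permutes_not_in)
  have supp: "support \<sigma> j = insert_after i (Suc n) (support p j)" if "j \<noteq> Suc n" for j
    unfolding \<sigma>_def using assms(2) that by (intro support_comp_transpose perm fixed) auto
  \<comment> \<open>The cycle of \<open>Suc n\<close> contains \<open>p i\<close>, which is at most
    \<open>n\<close>, so \<open>Suc n\<close> is not its minimum.\<close>
  have "permutation \<sigma>"
    unfolding \<sigma>_def by (intro permutation_compose perm permutation_swap_id)
  then have "set (support \<sigma> (Suc n)) = range (\<lambda>k. (\<sigma> ^^ k) (Suc n))"
    by (rule support_set)
  moreover have "(\<sigma> ^^ 1) (Suc n) = p i"
    by (simp add: \<sigma>_def)
  ultimately have "p i \<in> set (support \<sigma> (Suc n))"
    by (metis rangeI)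
  moreover have "p i \<le> n"
    using permutes_in_image[OF assms(1), of i] assms(2) by simp
  ultimately have last: "\<not> (\<forall>j\<in>set (support \<sigma> (Suc n)). Suc n \<le> j)"
    by (metis not_less_eq_eq)
  have minimal: "(\<forall>k\<in>set (support \<sigma> j). j \<le> k) \<longleftrightarrow> (\<forall>k\<in>set (support p j). j \<le> k)"
    if "j \<in> {1..n}" for j
    using that by (subst supp) (auto simp: set_insert_after simp del: set_map)
  show minima: "cycle_minima (Suc n) \<sigma> = cycle_minima n p"
  proof (rule set_eqI)
    fix j
    show "j \<in> cycle_minima (Suc n) \<sigma> \<longleftrightarrow> j \<in> cycle_minima n p"
      using last minimal[of j] unfolding cycle_minima_def
      by (cases "j = Suc n") (auto simp del: set_map simp: le_Suc_eq)
  qed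
  have "set (sorted_list_of_set (cycle_minima n p)) \<subseteq> {1..n}"
    by (auto simp: cycle_minima_def)
  then have "map (support \<sigma>) (sorted_list_of_set (cycle_minima n p)) =
      map (\<lambda>j. insert_after i (Suc n) (support p j)) (sorted_list_of_set (cycle_minima n p))"
    by (intro map_cong refl supp) auto
  also have "\<dots> = map (insert_after i (Suc n)) (map (support p) (sorted_list_of_set (cycle_minima n p)))"
    by (simp only: map_map comp_def)
  finally show "Flatten (Suc n) \<sigma> = insert_after i (Suc n) (Flatten n p)"
    by (simp only: Flatten_def standard_cycle_form_def minima insert_after_concat)
qed

text \<open>The fixed point \<open>Suc n\<close> is a cycle of its own with the largest minimum, so
  it comes last.\<close>

lemma Flatten_Suc:
  assumes "p permutes {1..n}"
  shows "Flatten (Suc n) p = Flatten n p @ [Suc n]"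
proof -
  have supp: "support p (Suc n) = [Suc n]"
    using assms by (intro support_fixpoint permutes_not_in) auto
  have "cycle_minima (Suc n) p = insert (Suc n) (cycle_minima n p)"
  proof (rule set_eqI)
    fix j
    show "j \<in> cycle_minima (Suc n) p \<longleftrightarrow> j \<in> insert (Suc n) (cycle_minima n p)"
      using supp unfolding cycle_minima_def
      by (cases "j = Suc n") (auto simp del: set_map simp: le_Suc_eq)
  qed
  moreover have "finite (cycle_minima n p)" and "\<forall>j\<in>cycle_minima n p. j \<le> n"
    by (auto simp: cycle_minima_def)
  moreover from this have "Suc n \<notin> cycle_minima n p"
    by auto
  ultimately have "sorted_list_of_set (cycle_minima (Suc n) p) =
      sorted_list_of_set (cycle_minima n p) @ [Suc n]"
    by (simp add: sorted_list_of_set_insert sorted_insort_is_snoc le_SucI)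
  then show ?thesis
    by (simp only: Flatten_def standard_cycle_form_def map_append concat_append list.map supp)
       simp
qed

subsection \<open>Recurrences\<close>

text \<open>\<open>sum_over_permutations_insert\<close> has the transposition on the left. Passing
  to inverses moves it to the right, where it places \<open>a\<close> behind \<open>b\<close>, or
  keeps \<open>a\<close> fixed if \<open>b = a\<close>.\<close>

lemma sum_over_permutations_insert_right:
  assumes "finite S" and "a \<notin> S"
  shows "(\<Sum>p | p permutes insert a S. f p) =
    (\<Sum>p | p permutes S. \<Sum>b\<in>insert a S. f (p \<circ> transpose b a))"
proof -
  have inv: "inv (transpose a b \<circ> p) = inv p \<circ> transpose b a" if "p permutes S" for p b
    using permutes_bij[OF that] by (simp add: o_inv_distrib transpose_commute)
  have "(\<Sum>p | p permutes insert a S. f p) = (\<Sum>p | p permutes insert a S. f (inv p))"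
    by (rule sum_permutations_inverse)
  also have "\<dots> = (\<Sum>b\<in>insert a S. \<Sum>p | p permutes S. f (inv (transpose a b \<circ> p)))"
    by (rule sum_over_permutations_insert[OF assms])
  also have "\<dots> = (\<Sum>b\<in>insert a S. \<Sum>p | p permutes S. f (inv p \<circ> transpose b a))"
    by (simp add: inv)
  also have "\<dots> = (\<Sum>b\<in>insert a S. \<Sum>p | p permutes S. f (p \<circ> transpose b a))"
    by (subst (2) sum_permutations_inverse) simp
  also have "\<dots> = (\<Sum>p | p permutes S. \<Sum>b\<in>insert a S. f (p \<circ> transpose b a))"
    by (rule sum.swap)
  finally show ?thesis .
qed

text \<open>Removing \<open>Suc n\<close> from its cycle writes \<open>p\<close> as
  \<open>s \<circ> transpose i (Suc n)\<close>, and the word of \<open>p\<close> is that of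
  \<open>s\<close> with one more letter.\<close>

lemma Flatten_in_permutations_of_set:
  "p permutes {1..n} \<Longrightarrow> Flatten n p \<in> permutations_of_set {1..n}"
proof (induction n arbitrary: p)
  case 0
  then show ?case
    by (simp add: Flatten_def standard_cycle_form_def cycle_minima_def)
next
  case (Suc n)
  have Suc_set: "{1..Suc n} = insert (Suc n) {1..n}" by auto
  \<comment> \<open>\<open>permutes_insert\<close> puts the transposition on the left, so it is
    applied to the inverse.\<close>
  have "inv p \<in> {p. p permutes insert (Suc n) {1..n}}"
    using permutes_inv[OF Suc.prems] unfolding Suc_set by simp
  then obtain i r where r: "inv p = transpose (Suc n) i \<circ> r" "i \<in> insert (Suc n) {1..n}"
      "r permutes {1..n}"
    unfolding permutes_insert by auto
  define s where "s = inv r"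
  have s: "s permutes {1..n}"
    unfolding s_def by (rule permutes_inv[OF r(3)])
  have "p = inv (inv p)"
    by (simp add: permutes_inv_inv[OF Suc.prems])
  also have "\<dots> = s \<circ> transpose i (Suc n)"
    using permutes_bij[OF r(3)] by (simp add: r(1) s_def o_inv_distrib transpose_commute)
  finally have p: "p = s \<circ> transpose i (Suc n)" .
  have IH: "set (Flatten n s) = {1..n}" "distinct (Flatten n s)"
    using Suc.IH[OF s] by (simp_all add: permutations_of_set_def)
  show ?case
  proof (cases "i = Suc n")
    case True
    then show ?thesis
      using IH by (auto simp: p Flatten_Suc[OF s] permutations_of_set_def)
  next
    case False
    then have i: "i \<in> {1..n}" using r(2) by simp
    then obtain k where k: "k < length (Flatten n s)" "Flatten n s ! k = i"
      using IH(1) by (metis in_set_conv_nth)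
    have "Flatten (Suc n) p = take (Suc k) (Flatten n s) @ Suc n # drop (Suc k) (Flatten n s)"
      unfolding p Flatten_comp_transpose[OF s i] using insert_after_nth[OF IH(2) k(1)] k(2) by simp
    \<comment> \<open>Letters and distinctness depend only on the multiset, so the new letter may be
      moved to the end.\<close>
    moreover have "mset (us @ a # vs) = mset ((us @ vs) @ [a])" for us vs and a :: nat
      by simp
    ultimately have "mset (Flatten (Suc n) p) = mset (Flatten n s @ [Suc n])"
      by (metis append_take_drop_id)
    then have "set (Flatten (Suc n) p) = set (Flatten n s @ [Suc n])"
      and "distinct (Flatten (Suc n) p) \<longleftrightarrow> distinct (Flatten n s @ [Suc n])"
      by (rule mset_eq_setD, rule mset_eq_imp_distinct_iff)
    then show ?thesis
      using IH unfolding permutations_of_set_def by auto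
  qed
qed

text \<open>Initial value for \<open>F21_Suc\<close>, whose count of slots presupposes nonempty
  words.\<close>

lemma F21_1: "F21 (Suc 0) = 1"
proof -
  have "des (Flatten (Suc 0) id) = 0"
    using Flatten_in_permutations_of_set[of id "Suc 0"] by (simp add: permutes_id)
  then show ?thesis
    by (simp add: F21_def id_def)
qed

text \<open>The words have length \<open>Suc n\<close>, hence \<open>n\<close> inner gaps. In
  \<open>2 * F\<close> one summand comes from inserting behind the last letter, the other from the
  new fixed point.\<close>

lemma F21_Suc:
  fixes n :: nat
  defines "F \<equiv> F21 (Suc n)"
  shows "F21 (Suc (Suc n)) = 2 * F + of_nat n * X * F + X * (1 - X) * pderiv F"
proof -
  let ?m = "Suc (Suc n)"
  let ?P = "\<lambda>p. monom 1 (des (Flatten (Suc n) p)) :: rat poly"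
  have Suc_set: "{1..?m} = insert ?m {1..Suc n}" by auto
  have step: "(\<Sum>b\<in>insert ?m {1..Suc n}. monom 1 (des (Flatten ?m (p \<circ> transpose b ?m)))) =
      2 * ?P p + of_nat n * X * ?P p + X * (1 - X) * pderiv (?P p)"
    if p: "p permutes {1..Suc n}" for p
  proof -
    define w where "w = Flatten (Suc n) p"
    have w: "distinct w" "set w = {1..Suc n}"
      using Flatten_in_permutations_of_set[OF p] by (simp_all add: w_def permutations_of_set_def)
    have len: "length w = Suc n"
      using distinct_card[OF w(1)] w(2) by simp
    have less: "x < ?m" if "x \<in> set w" for x
      using that w(2) by auto
    have "(\<Sum>b\<in>{1..Suc n}. monom 1 (des (Flatten ?m (p \<circ> transpose b ?m)))) =
        (\<Sum>b\<in>set w. monom 1 (des (insert_after b ?m w)) :: rat poly)"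
      unfolding w(2) by (intro sum.cong refl) (simp only: Flatten_comp_transpose[OF p] w_def)
    \<comment> \<open>Letters are exchanged for their positions in \<open>w\<close>.\<close>
    also have "\<dots> = (\<Sum>k<length w. monom 1 (des (insert_after (w ! k) ?m w)))"
      by (rule sum.reindex_bij_betw[symmetric]) (simp add: bij_betw_nth w)
    also have "\<dots> = (\<Sum>k<length w. monom 1 (des (take (Suc k) w @ ?m # drop (Suc k) w)))"
      by (simp add: insert_after_nth w(1))
    also have "\<dots> = ?P p + of_nat n * X * ?P p + X * (1 - X) * pderiv (?P p)"
      using sum_des_insert_max[of w ?m] less len by (fastforce simp: w_def)
    finally have "(\<Sum>b\<in>{1..Suc n}. monom 1 (des (Flatten ?m (p \<circ> transpose b ?m)))) =
        ?P p + of_nat n * X * ?P p + X * (1 - X) * pderiv (?P p)" .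
    moreover have "monom 1 (des (Flatten ?m (p \<circ> transpose ?m ?m))) = ?P p"
      using less by (simp add: Flatten_Suc[OF p] des_append_greater w_def)
    ultimately show ?thesis
      by (subst sum.insert) (simp_all only: finite_atLeastAtMost, auto simp: algebra_simps)
  qed
  have "F21 ?m = (\<Sum>p | p permutes {1..Suc n}.
      \<Sum>b\<in>insert ?m {1..Suc n}. monom 1 (des (Flatten ?m (p \<circ> transpose b ?m))))"
    unfolding F21_def Suc_set by (rule sum_over_permutations_insert_right) auto
  also have "\<dots> = (\<Sum>p | p permutes {1..Suc n}.
      2 * ?P p + of_nat n * X * ?P p + X * (1 - X) * pderiv (?P p))"
    using step by (intro sum.cong refl) simp
  also have "\<dots> = 2 * F + of_nat n * X * F + X * (1 - X) * pderiv F"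
    unfolding F_def F21_def by (simp only: sum.distrib sum_distrib_left pderiv_sum)
  finally show ?thesis .
qed

section \<open>Eulerian polynomials and their recurrence\<close>

lemma eulerian_poly_conv_sum_asc:
  "eulerian_poly n = (\<Sum>w\<in>permutations_of_set {1..n}. monom 1 (asc w))"
proof -
  have le: "asc w \<le> n" if "w \<in> permutations_of_set {1..n}" for w
  proof -
    have "length w = n"
      using that by (simp add: length_finite_permutations_of_set)
    then have "asc w \<le> card {..<n}"
      unfolding asc_def by (intro card_mono) auto
    then show ?thesis by simp
  qed
  have "(\<Sum>w\<in>permutations_of_set {1..n}. monom 1 (asc w) :: rat poly) =
      (\<Sum>k\<in>{0..n}. \<Sum>w | w \<in> permutations_of_set {1..n} \<and> asc w = k. monom 1 (asc w))"
    using le by (intro sum.group[symmetric]) auto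
  also have "\<dots> = eulerian_poly n"
    unfolding eulerian_poly_def eulerian_number_def
    by (intro sum.cong refl) (simp add: of_nat_monom mult_monom)
  finally show ?thesis ..
qed

text \<open>Reversal permutes the words and exchanges ascents with descents, which makes
  \<open>sum_des_insert_max\<close> applicable.\<close>

lemma eulerian_poly_conv_sum_des:
  "eulerian_poly n = (\<Sum>w\<in>permutations_of_set {1..n}. monom 1 (des w))"
  unfolding eulerian_poly_conv_sum_asc asc_eq_des_rev
  by (rule sum.reindex_bij_witness[of _ rev rev]) (auto simp: permutations_of_set_def)

text \<open>Deleting \<open>a\<close> and recording how many letters precede it inverts the
  insertion.\<close>

lemma sum_permutations_of_set_insert:
  assumes "finite S" and "a \<notin> S"
  shows "(\<Sum>v\<in>permutations_of_set (insert a S). f v) =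
    (\<Sum>w\<in>permutations_of_set S. \<Sum>k\<le>card S. f (take k w @ a # drop k w))"
proof -
  let ?ins = "\<lambda>(w, k). take k w @ a # drop k w"
  have "(\<Sum>v\<in>permutations_of_set (insert a S). f v) =
      (\<Sum>x\<in>permutations_of_set S \<times> {..card S}. f (?ins x))"
  proof (rule sum.reindex_bij_witness[where i = ?ins
        and j = "\<lambda>v. (removeAll a v, length (takeWhile (\<lambda>x. x \<noteq> a) v))"])
    fix v assume v: "v \<in> permutations_of_set (insert a S)"
    then have "a \<in> set v" by (simp add: permutations_of_set_def)
    then obtain us vs where split: "v = us @ a # vs" by (meson split_list)
    with v have us: "a \<notin> set us" "a \<notin> set vs" by (auto simp: permutations_of_set_def)
    have tw: "takeWhile (\<lambda>x. x \<noteq> a) v = us"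
      unfolding split by (subst takeWhile_append2) (use us(1) in auto)
    have ra: "removeAll a v = us @ vs"
      using us by (simp add: split)
    show "?ins (removeAll a v, length (takeWhile (\<lambda>x. x \<noteq> a) v)) = v"
      unfolding tw ra by (simp add: split)
    show "f (?ins (removeAll a v, length (takeWhile (\<lambda>x. x \<noteq> a) v))) = f v"
      unfolding tw ra by (simp add: split)
    have "us @ vs \<in> permutations_of_set S"
      using v us assms(2) by (auto simp: split permutations_of_set_def)
    moreover from this have "length us \<le> card S"
      using length_finite_permutations_of_set[of "us @ vs" S] by simp
    ultimately show "(removeAll a v, length (takeWhile (\<lambda>x. x \<noteq> a) v)) \<in>
        permutations_of_set S \<times> {..card S}"
      by (simp add: tw ra)
  next
    fix x assume "x \<in> permutations_of_set S \<times> {..card S}"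
    then obtain w k where x: "x = (w, k)" "w \<in> permutations_of_set S" "k \<le> card S" by auto
    define us vs where "us = take k w" and "vs = drop k w"
    have w: "w = us @ vs" by (simp add: us_def vs_def)
    have len: "length us = k"
      using x by (simp add: us_def length_finite_permutations_of_set)
    have notin: "a \<notin> set us" "a \<notin> set vs"
      using x(2) assms(2) by (auto simp: w permutations_of_set_def)
    have tw: "takeWhile (\<lambda>y. y \<noteq> a) (us @ a # vs) = us"
      by (subst takeWhile_append2) (use notin(1) in auto)
    show "(removeAll a (?ins x), length (takeWhile (\<lambda>y. y \<noteq> a) (?ins x))) = x"
      using notin len tw by (simp add: x(1) w)
    show "?ins x \<in> permutations_of_set (insert a S)"
      using x(2) notin len by (auto simp: x(1) w permutations_of_set_def)
  qed
  then show ?thesis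
    by (simp add: sum.cartesian_product case_prod_unfold)
qed

lemma eulerian_poly_0: "eulerian_poly 0 = 1"
  by (simp add: eulerian_poly_conv_sum_des)

lemma eulerian_poly_Suc:
  fixes n :: nat
  defines "A \<equiv> eulerian_poly n"
  shows "eulerian_poly (Suc n) = A + of_nat n * X * A + X * (1 - X) * pderiv A"
\<comment> \<open>The empty word is separate: its front and its end are the same slot.\<close>
proof (cases n)
  case 0
  then show ?thesis
    by (simp add: A_def eulerian_poly_conv_sum_des)
next
  case (Suc l)
  let ?P = "\<lambda>w. monom 1 (des w) :: rat poly"
  have Suc_set: "{1..Suc n} = insert (Suc n) {1..n}" by auto
  have step: "(\<Sum>k\<le>card {1..n}. ?P (take k w @ Suc n # drop k w)) =
      ?P w + of_nat n * X * ?P w + X * (1 - X) * pderiv (?P w)"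
    if "w \<in> permutations_of_set {1..n}" for w
  proof -
    have w: "set w = {1..n}" "length w = n"
      using that length_finite_permutations_of_set[OF that] by (simp_all add: permutations_of_set_def)
    have less: "x < Suc n" if "x \<in> set w" for x
      using that w(1) by auto
    have ne: "w \<noteq> []" using w(2) Suc by auto
    \<comment> \<open>The slot \<open>k = 0\<close> is the front; all others lie behind a
      letter.\<close>
    have "(\<Sum>k\<le>card {1..n}. ?P (take k w @ Suc n # drop k w)) =
        ?P (Suc n # w) + (\<Sum>k<length w. ?P (take (Suc k) w @ Suc n # drop (Suc k) w))"
      by (simp add: w(2) sum.lessThan_Suc_shift flip: lessThan_Suc_atMost del: sum.lessThan_Suc)
    also have "?P (Suc n # w) = X * ?P w"
      using des_Cons_greater[OF less ne] by (simp add: monom_Suc)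
    also have "(\<Sum>k<length w. ?P (take (Suc k) w @ Suc n # drop (Suc k) w)) =
        ?P w + of_nat (n - 1) * X * ?P w + X * (1 - X) * pderiv (?P w)"
      using sum_des_insert_max[OF ne less] by (simp only: w(2))
    finally show ?thesis
      by (simp only: Suc diff_Suc_1 of_nat_Suc) (simp only: algebra_simps mult_1_left)
  qed
  have "eulerian_poly (Suc n) =
      (\<Sum>w\<in>permutations_of_set {1..n}. \<Sum>k\<le>card {1..n}. ?P (take k w @ Suc n # drop k w))"
    unfolding eulerian_poly_conv_sum_des Suc_set
    by (rule sum_permutations_of_set_insert) auto
  also have "\<dots> = (\<Sum>w\<in>permutations_of_set {1..n}.
      ?P w + of_nat n * X * ?P w + X * (1 - X) * pderiv (?P w))"
    using step by (intro sum.cong refl)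
  also have "\<dots> = A + of_nat n * X * A + X * (1 - X) * pderiv A"
    unfolding A_def eulerian_poly_conv_sum_des
    by (simp only: sum.distrib sum_distrib_left pderiv_sum)
  finally show ?thesis .
qed

subsection \<open>Power series in \<open>q\<close>\<close>

unbundle fps_syntax

text \<open>With \<open>j = k + 1\<close> this is the sum of \<open>j ^ n * q ^ (j - 1)\<close> over
  \<open>j \<ge> 1\<close>.\<close>

definition eulerian_series :: "nat \<Rightarrow> rat fps" where
  "eulerian_series n = Abs_fps (\<lambda>k. of_nat (Suc k) ^ n)"

text \<open>With \<open>j = k + 2\<close> this is the sum of
  \<open>(j - 1) * j ^ n * q ^ (j - 2)\<close>, whose term at \<open>j = 1\<close> vanishes. It
  belongs to \<open>F21 (Suc n)\<close>.\<close>

definition flatten_series :: "nat \<Rightarrow> rat fps" where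
  "flatten_series n = Abs_fps (\<lambda>k. of_nat (Suc k) * of_nat (k + 2) ^ n)"

lemma fps_of_poly_of_nat: "fps_of_poly (of_nat n) = of_nat n"
  by (induction n) (simp_all add: fps_of_poly_add)

lemma one_minus_X_times_geometric: "(1 - fps_X) * Abs_fps (\<lambda>_. 1 :: rat) = 1"
  by (rule fps_ext) (simp add: algebra_simps)

lemma fps_deriv_one_minus_X_power:
  "fps_deriv ((1 - fps_X) ^ Suc n :: rat fps) = - of_nat (Suc n) * (1 - fps_X) ^ n"
  unfolding fps_deriv_power by (simp add: fps_of_nat del: power_Suc of_nat_Suc)

text \<open>The recurrence becomes \<open>G + fps_X * fps_deriv G\<close> on the series, an operator
  that multiplies the coefficient at \<open>k\<close> by \<open>1 + k\<close>.\<close>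

lemma fps_of_poly_eulerian_poly:
  "fps_of_poly (eulerian_poly n) = (1 - fps_X) ^ Suc n * eulerian_series n"
proof (induction n)
  case 0
  have "(1 - fps_X) * Abs_fps (\<lambda>_. 1 :: rat) = 1"
    by (rule one_minus_X_times_geometric)
  then show ?case
    by (simp add: eulerian_poly_0 eulerian_series_def)
next
  case (Suc n)
  define A where "A = fps_of_poly (eulerian_poly n)"
  define G where "G = eulerian_series n"
  define u where "u = (1 - fps_X :: rat fps) ^ n"
  have A: "A = (1 - fps_X) * u * G"
    using Suc by (simp add: A_def G_def u_def)
  have dA: "fps_deriv A = (1 - fps_X) * u * fps_deriv G - of_nat (Suc n) * u * G"
    using fps_deriv_one_minus_X_power[of n] unfolding A u_def power_Suc[symmetric] fps_deriv_mult
    by (simp only:) (simp only: algebra_simps mult_minus_left mult_minus_right right_minus add_0_left add_0_right)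
  have G_Suc: "eulerian_series (Suc n) = G + fps_X * fps_deriv G"
    by (rule fps_ext) (simp add: G_def eulerian_series_def algebra_simps)
  have "fps_of_poly (eulerian_poly (Suc n)) =
      A + of_nat n * fps_X * A + fps_X * (1 - fps_X) * fps_deriv A"
    unfolding eulerian_poly_Suc A_def
    by (simp add: fps_of_poly_simps fps_of_poly_of_nat fps_of_poly_pderiv)
  \<comment> \<open>The terms in \<open>G\<close> collect the factor
    \<open>1 + n q - (n + 1) q = 1 - q\<close>.\<close>
  also have "\<dots> = (1 - fps_X) ^ 2 * u * (G + fps_X * fps_deriv G)"
    unfolding dA unfolding A by (simp add: algebra_simps power2_eq_square)
  also have "\<dots> = (1 - fps_X) ^ Suc (Suc n) * eulerian_series (Suc n)"
    unfolding G_Suc u_def by (simp add: power2_eq_square algebra_simps)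
  finally show ?case .
qed

text \<open>As for \<open>fps_of_poly_eulerian_poly\<close>, with an operator that multiplies the
  coefficient at \<open>k\<close> by \<open>2 + k\<close>.\<close>

lemma fps_of_poly_F21:
  "fps_of_poly (F21 (Suc n)) = (1 - fps_X) ^ Suc (Suc n) * flatten_series n"
proof (induction n)
  case 0
  have "(1 - fps_X) * Abs_fps (\<lambda>k. of_nat (Suc k) :: rat) = Abs_fps (\<lambda>_. 1)"
    by (rule fps_ext) (simp add: algebra_simps)
  moreover have "(1 - fps_X) * Abs_fps (\<lambda>_. 1 :: rat) = 1"
    by (rule one_minus_X_times_geometric)
  ultimately show ?case
    by (simp add: F21_1 flatten_series_def mult.assoc)
next
  case (Suc n)
  define F where "F = fps_of_poly (F21 (Suc n))"
  define H where "H = flatten_series n"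
  define u where "u = (1 - fps_X :: rat fps) ^ Suc n"
  have F: "F = (1 - fps_X) * u * H"
    using Suc by (simp add: F_def H_def u_def)
  have dF: "fps_deriv F = (1 - fps_X) * u * fps_deriv H - of_nat (Suc (Suc n)) * u * H"
    using fps_deriv_one_minus_X_power[of "Suc n"] unfolding F u_def power_Suc[symmetric] fps_deriv_mult
    by (simp only:) (simp only: algebra_simps mult_minus_left mult_minus_right right_minus add_0_left add_0_right)
  have H_Suc: "flatten_series (Suc n) = 2 * H + fps_X * fps_deriv H"
    by (rule fps_ext) (simp add: H_def flatten_series_def algebra_simps numeral_fps_const)
  have "fps_of_poly (F21 (Suc (Suc n))) =
      2 * F + of_nat n * fps_X * F + fps_X * (1 - fps_X) * fps_deriv F"
    unfolding F21_Suc F_def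
    by (simp add: fps_of_poly_simps fps_of_poly_of_nat fps_of_poly_pderiv)
  \<comment> \<open>Here the factor is \<open>2 + n q - (n + 2) q = 2 (1 - q)\<close>.\<close>
  also have "\<dots> = (1 - fps_X) ^ 2 * u * (2 * H + fps_X * fps_deriv H)"
    unfolding dF unfolding F by (simp add: algebra_simps power2_eq_square)
  also have "\<dots> = (1 - fps_X) ^ Suc (Suc (Suc n)) * flatten_series (Suc n)"
    unfolding H_Suc u_def by (simp add: power2_eq_square algebra_simps)
  finally show ?case .
qed

text \<open>On coefficients, \<open>k * (k + 1) ^ n = (k + 1) ^ Suc n - (k + 1) ^ n\<close>. The
  prefactor exceeds that of \<open>eulerian_poly n\<close> by one power of \<open>1 - fps_X\<close>,
  which leaves \<open>fps_X - 1\<close>.\<close>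

lemma X_times_fps_of_poly_F21:
  "fps_X * fps_of_poly (F21 (Suc n)) =
    fps_of_poly (eulerian_poly (Suc n)) + (fps_X - 1) * fps_of_poly (eulerian_poly n)"
proof -
  have "fps_X * flatten_series n = eulerian_series (Suc n) - eulerian_series n"
  proof (rule fps_ext)
    fix k
    show "(fps_X * flatten_series n) $ k = (eulerian_series (Suc n) - eulerian_series n) $ k"
      by (cases k) (simp_all add: flatten_series_def eulerian_series_def algebra_simps)
  qed
  then have "fps_X * fps_of_poly (F21 (Suc n)) =
      (1 - fps_X) ^ Suc (Suc n) * (eulerian_series (Suc n) - eulerian_series n)"
    by (simp add: fps_of_poly_F21 mult.left_commute)
  then show ?thesis
    by (simp add: fps_of_poly_eulerian_poly algebra_simps)
qed

text \<open>This is \<open>A(x, q) e^((q-1)x) = q A(x, q) + 1 - q\<close>, read off at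
  \<open>x^n / n!\<close>.\<close>

lemma sum_binomial_eulerian_poly:
  "(\<Sum>i\<le>n. of_nat (n choose i) * fps_of_poly (eulerian_poly i) * (fps_X - 1) ^ (n - i)) =
    fps_X * fps_of_poly (eulerian_poly n) + (if n = 0 then 1 - fps_X else 0)"
proof -
  \<comment> \<open>At each \<open>k\<close> this is the binomial theorem for
    \<open>((k + 1) - 1) ^ n\<close>.\<close>
  have series: "(\<Sum>i\<le>n. of_nat (n choose i) * (- 1) ^ (n - i) * eulerian_series i) =
      Abs_fps (\<lambda>k. of_nat k ^ n)"
  proof (rule fps_ext)
    fix k
    have "(\<Sum>i\<le>n. of_nat (n choose i) * (- 1) ^ (n - i) * eulerian_series i) $ k =
        (\<Sum>i\<le>n. of_nat (n choose i) * of_nat (Suc k) ^ i * (- 1 :: rat) ^ (n - i))"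
    proof (subst fps_sum_nth, intro sum.cong refl)
      fix i
      have "of_nat (n choose i) * (- 1) ^ (n - i) =
          (fps_const (of_nat (n choose i) * (- 1) ^ (n - i)) :: rat fps)"
        by (simp flip: fps_const_mult fps_const_power fps_const_neg add: fps_of_nat)
      then show "(of_nat (n choose i) * (- 1) ^ (n - i) * eulerian_series i) $ k =
          of_nat (n choose i) * of_nat (Suc k) ^ i * (- 1) ^ (n - i)"
        by (simp add: eulerian_series_def)
    qed
    also have "\<dots> = (of_nat (Suc k) + - 1) ^ n"
      by (rule binomial_ring[symmetric])
    finally show "(\<Sum>i\<le>n. of_nat (n choose i) * (- 1) ^ (n - i) * eulerian_series i) $ k =
        Abs_fps (\<lambda>k. of_nat k ^ n) $ k"
      by simp
  qed
  \<comment> \<open>Trading \<open>fps_X - 1\<close> for \<open>1 - fps_X\<close> up to sign gives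
    every summand the same power \<open>Suc n\<close>.\<close>
  have pow: "(fps_X - 1) ^ (n - i) * (1 - fps_X) ^ Suc i =
      (- 1) ^ (n - i) * (1 - fps_X :: rat fps) ^ Suc n" if "i \<le> n" for i
  proof -
    have "(fps_X - 1 :: rat fps) ^ (n - i) = (- 1) ^ (n - i) * (1 - fps_X) ^ (n - i)"
      by (simp flip: power_mult_distrib)
    then show ?thesis
      using that by (simp add: mult.assoc flip: power_add)
  qed
  have "of_nat (n choose i) * fps_of_poly (eulerian_poly i) * (fps_X - 1) ^ (n - i) =
      (1 - fps_X) ^ Suc n * (of_nat (n choose i) * (- 1) ^ (n - i) * eulerian_series i)"
    if "i \<le> n" for i
  proof -
    have "of_nat (n choose i) * fps_of_poly (eulerian_poly i) * (fps_X - 1) ^ (n - i) =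
        of_nat (n choose i) * eulerian_series i * ((fps_X - 1) ^ (n - i) * (1 - fps_X) ^ Suc i)"
      unfolding fps_of_poly_eulerian_poly by (simp only: mult_ac)
    also have "\<dots> = of_nat (n choose i) * eulerian_series i * ((- 1) ^ (n - i) * (1 - fps_X) ^ Suc n)"
      using pow[OF that] by (simp only:)
    finally show ?thesis
      by (simp only: mult_ac)
  qed
  then have "(\<Sum>i\<le>n. of_nat (n choose i) * fps_of_poly (eulerian_poly i) * (fps_X - 1) ^ (n - i)) =
      (\<Sum>i\<le>n. (1 - fps_X) ^ Suc n * (of_nat (n choose i) * (- 1) ^ (n - i) * eulerian_series i))"
    by (intro sum.cong refl) simp
  also have "\<dots> = (1 - fps_X) ^ Suc n * Abs_fps (\<lambda>k. of_nat k ^ n)"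
    by (simp only: series flip: sum_distrib_left)
  also have "\<dots> = fps_X * fps_of_poly (eulerian_poly n) + (if n = 0 then 1 - fps_X else 0)"
  proof -
    \<comment> \<open>The coefficient \<open>0 ^ n\<close> at \<open>k = 0\<close> is nonzero only
      for \<open>n = 0\<close>, which is the source of the exceptional term.\<close>
    have "Abs_fps (\<lambda>k. of_nat k ^ n) = fps_X * eulerian_series n + (if n = 0 then 1 else 0)"
    proof (rule fps_ext)
      fix k
      show "Abs_fps (\<lambda>k. of_nat k ^ n) $ k =
          (fps_X * eulerian_series n + (if n = 0 then 1 else 0)) $ k"
        by (cases k) (simp_all add: eulerian_series_def)
    qed
    then show ?thesis
      unfolding fps_of_poly_eulerian_poly by (simp add: algebra_simps)
  qed
  finally show ?thesis .
qed

section \<open>Convergence in the q-adic metric\<close>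

lemma dist_fls_less:
  fixes f g :: "'a :: group_add fls"
  assumes "\<And>k. k \<le> int N \<Longrightarrow> f $$ k = g $$ k"
  shows "dist f g < (1 / 2) ^ N"
proof (cases "f = g")
  case False
  then have "int N < fls_subdegree (f - g)"
    using assms by (intro fls_subdegree_greaterI) auto
  then have "(1 / 2 :: real) ^ nat (fls_subdegree (f - g)) < (1 / 2) ^ N"
    by (intro power_strict_decreasing) auto
  then show ?thesis
    using False \<open>int N < _\<close> by (simp add: dist_fls_def power_one_over inverse_eq_divide)
qed simp

text \<open>Each summand is a multiple of \<open>q powi (int j - 2)\<close>, so any finite partial
  sum containing the indices \<open>1\<close> to \<open>N + 2\<close> has the right coefficients up
  to \<open>N\<close>.\<close>

lemma has_sum_flatten_series:
  "((\<lambda>j::nat. (of_nat j - 1) * of_nat j ^ n * q powi (int j - 2))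
    has_sum fps_to_fls (flatten_series n)) {1..}"
proof -
  define c where "c j = ((of_nat j - 1) * of_nat j ^ n :: rat)" for j :: nat
  define t where "t j = fls_shift (2 - int j) (fls_const (c j))" for j
  have t: "(of_nat j - 1) * of_nat j ^ n * q powi (int j - 2) = t j" for j
  proof -
    have "(of_nat j - 1) * of_nat j ^ n = fls_const (c j)"
      unfolding c_def
      by (simp add: fls_of_nat fls_const_power flip: fls_const_mult_const fls_minus_const fls_const_1)
    moreover have "q powi (int j - 2) = fls_X_intpow (int j - 2)"
      by (rule fls_X_power_int)
    ultimately show ?thesis
      by (simp only: t_def fls_X_intpow_times_conv_shift) (simp only: minus_diff_eq)
  qed
  let ?S = "fps_to_fls (flatten_series n)"
  have nth: "(\<Sum>j\<in>Y. t j) $$ k = ?S $$ k"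
    if Y: "finite Y" "Y \<subseteq> {1..}" "{1..N + 2} \<subseteq> Y" and k: "k \<le> int N" for Y N k
  proof (cases "k < 0")
    case True
    \<comment> \<open>Only \<open>j = 1\<close> has a negative exponent, and
      \<open>c 1 = 0\<close>.\<close>
    have "t j $$ k = 0" if "j \<in> Y" for j
      using True Y(2) that by (cases "j = 1") (auto simp: t_def c_def)
    then show ?thesis
      using True by (simp add: fls_nth_sum)
  next
    case False
    then obtain l where l: "k = int l" by (metis nonneg_int_cases not_less)
    then have "l + 2 \<in> Y" using k Y(3) by auto
    have "(\<Sum>j\<in>Y. t j) $$ k = (\<Sum>j\<in>Y. if j = l + 2 then c j else 0)"
      unfolding fls_nth_sum by (intro sum.cong refl) (auto simp: t_def l)
    also have "\<dots> = c (l + 2)"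
      using Y(1) \<open>l + 2 \<in> Y\<close> by simp
    also have "\<dots> = ?S $$ k"
      by (simp add: l c_def flatten_series_def algebra_simps)
    finally show ?thesis .
  qed
  have "(sum t \<longlongrightarrow> ?S) (finite_subsets_at_top {1..})"
  proof (rule tendstoI)
    fix e :: real assume "e > 0"
    then obtain N where N: "(1 / 2) ^ N < e"
      using real_arch_pow_inv[of e "1 / 2"] by auto
    show "\<forall>\<^sub>F Y in finite_subsets_at_top {1..}. dist (sum t Y) ?S < e"
      unfolding eventually_finite_subsets_at_top
    proof (intro exI conjI allI impI)
      fix Y assume Y: "finite Y \<and> {1..N + 2} \<subseteq> Y \<and> Y \<subseteq> {1..}"
      have "dist (sum t Y) ?S < (1 / 2) ^ N"
        using nth[of Y N] Y by (intro dist_fls_less) auto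
      with N show "dist (sum t Y) ?S < e" by simp
    qed auto
  qed
  then show ?thesis
    unfolding has_sum_def t .
qed

section \<open>Transfer of the identities to Laurent series\<close>

lemma in_q_F21:
  "in_q (F21 (Suc n)) = (1 - q) ^ (Suc n + 1) * fps_to_fls (flatten_series n)"
  unfolding in_q_def fps_of_poly_F21
  by (simp add: fls_times_fps_to_fls fps_to_fls_power)

lemma q_times_in_q_F21:
  "q * in_q (F21 (Suc n)) = in_q (eulerian_poly (Suc n)) + (q - 1) * in_q (eulerian_poly n)"
proof -
  have "fps_to_fls (fps_X * fps_of_poly (F21 (Suc n))) =
      fps_to_fls (fps_of_poly (eulerian_poly (Suc n)) + (fps_X - 1) * fps_of_poly (eulerian_poly n))"
    by (simp only: X_times_fps_of_poly_F21)
  then show ?thesis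
    by (simp add: in_q_def fls_times_fps_to_fls)
qed

lemma sum_binomial_in_q_eulerian_poly:
  "(\<Sum>i\<le>n. of_nat (n choose i) * in_q (eulerian_poly i) * (q - 1) ^ (n - i)) =
    q * in_q (eulerian_poly n) + (if n = 0 then 1 - q else 0)"
proof -
  have fps_to_fls_sum: "fps_to_fls (\<Sum>i\<in>I. f i) = (\<Sum>i\<in>I. fps_to_fls (f i))"
    for I :: "nat set" and f :: "nat \<Rightarrow> rat fps"
    by (induction I rule: infinite_finite_induct) simp_all
  have "fps_to_fls (\<Sum>i\<le>n. of_nat (n choose i) * fps_of_poly (eulerian_poly i) * (fps_X - 1) ^ (n - i)) =
      fps_to_fls (fps_X * fps_of_poly (eulerian_poly n) + (if n = 0 then 1 - fps_X else 0))"
    by (simp only: sum_binomial_eulerian_poly)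
  then show ?thesis
    by (simp add: in_q_def fps_to_fls_sum fls_times_fps_to_fls fps_to_fls_power fps_to_fls_of_nat
        split: if_splits)
qed

subsection \<open>Exponential generating functions\<close>

text \<open>The closed form of \<open>A(x, q)\<close> with its denominator cleared. The factorials
  turn the Cauchy product into the sum of \<open>sum_binomial_in_q_eulerian_poly\<close>.\<close>

lemma egf_eulerian_poly_times:
  "egf eulerian_poly * (fps_exp (q - 1) - fps_const q) = fps_const (1 - q)"
proof (rule fps_ext)
  fix n
  have "(egf eulerian_poly * fps_exp (q - 1)) $ n =
      (\<Sum>i\<le>n. in_q (eulerian_poly i) / fact i * ((q - 1) ^ (n - i) / fact (n - i)))"
    by (simp add: fps_mult_nth egf_def atLeast0AtMost)
  also have "\<dots> = (\<Sum>i\<le>n. of_nat (n choose i) * in_q (eulerian_poly i) * (q - 1) ^ (n - i)) / fact n"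
    unfolding sum_divide_distrib
    by (intro sum.cong refl) (simp add: binomial_fact field_simps)
  also have "\<dots> = (q * in_q (eulerian_poly n) + (if n = 0 then 1 - q else 0)) / fact n"
    by (simp only: sum_binomial_in_q_eulerian_poly)
  finally show "(egf eulerian_poly * (fps_exp (q - 1) - fps_const q)) $ n = fps_const (1 - q) $ n"
    by (simp add: right_diff_distrib mult.commute[of _ "fps_const q"])
       (simp add: egf_def add_divide_distrib)
qed

text \<open>Differentiation shifts the coefficients of an exponential generating function by one, so
  this collects \<open>q_times_in_q_F21\<close> over all \<open>n\<close>.\<close>

lemma egf_F21:
  "fps_const q * egf (\<lambda>n. F21 (n + 1)) =
    fps_deriv (egf eulerian_poly) + fps_const (q - 1) * egf eulerian_poly"
proof (rule fps_ext)
  fix n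
  have "of_nat (Suc n) * (in_q (eulerian_poly (Suc n)) / fact (Suc n)) =
      in_q (eulerian_poly (Suc n)) / fact n"
    by (simp add: field_simps del: of_nat_Suc)
  then have "fps_deriv (egf eulerian_poly) $ n = in_q (eulerian_poly (Suc n)) / fact n"
    by (simp add: egf_def del: of_nat_Suc fact_Suc)
  then show "(fps_const q * egf (\<lambda>n. F21 (n + 1))) $ n =
      (fps_deriv (egf eulerian_poly) + fps_const (q - 1) * egf eulerian_poly) $ n"
    using q_times_in_q_F21[of n] by (simp add: egf_def flip: add_divide_distrib)
qed

lemma one_minus_q_nonzero: "1 - q \<noteq> 0"
proof -
  have "(1 - q) $$ 0 \<noteq> 0" by simp
  then show ?thesis by (metis fls_zero_nth)
qed

text \<open>Differentiating \<open>A * D = 1 - Q\<close> in \<open>x\<close> eliminates the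
  derivative of \<open>A\<close> from \<open>egf_F21\<close>; the square appears on replacing
  \<open>1 - Q\<close> by \<open>A * D\<close>, and \<open>Q * D\<close> cancels.\<close>

lemma egf_F21_eq_square: "egf (\<lambda>n. F21 (n + 1)) = (egf eulerian_poly)\<^sup>2"
proof -
  define A where "A = egf eulerian_poly"
  define B where "B = egf (\<lambda>n. F21 (n + 1))"
  define Q where "Q = fps_const q"
  define D where "D = fps_exp (q - 1) - Q"
  have AD: "A * D = 1 - Q"
    using egf_eulerian_poly_times unfolding A_def D_def Q_def
    by (simp flip: fps_const_sub)
  have Q: "fps_const (q - 1) = Q - 1"
    unfolding Q_def by (simp flip: fps_const_sub)
  have QB: "Q * B = fps_deriv A + (Q - 1) * A"
    using egf_F21 Q unfolding A_def B_def Q_def by simp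
  \<comment> \<open>\<open>D + Q\<close> is the exponential, whose derivative is
    \<open>Q - 1\<close> times itself.\<close>
  have dD: "fps_deriv D = (Q - 1) * (D + Q)"
    unfolding D_def Q[symmetric] by (simp add: Q_def)
  have "fps_deriv (A * D) = 0"
    unfolding AD by (simp add: Q_def)
  then have dA: "fps_deriv A * D = - (A * ((Q - 1) * (D + Q)))"
    by (simp add: dD eq_neg_iff_add_eq_0 add.commute)
  have "Q * D * B = (fps_deriv A + (Q - 1) * A) * D"
    using QB by (metis mult.assoc mult.commute)
  \<comment> \<open>The two multiples of \<open>A * D\<close> cancel, and
    \<open>- (Q - 1) * Q * A\<close> is left.\<close>
  also have "\<dots> = Q * (1 - Q) * A"
    unfolding distrib_right dA by (simp add: algebra_simps)
  also have "\<dots> = Q * D * A\<^sup>2"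
    unfolding AD[symmetric] by (simp add: power2_eq_square algebra_simps)
  finally have "Q * D * B = Q * D * A\<^sup>2" .
  moreover have "Q \<noteq> 0" by (simp add: Q_def)
  moreover have "D \<noteq> 0"
  proof
    assume "D = 0"
    with AD have "fps_const (1 - q) = 0" by (simp add: Q_def flip: fps_const_sub)
    then show False using one_minus_q_nonzero by simp
  qed
  ultimately show ?thesis
    unfolding A_def B_def by simp
qed

theorem theorem2p1:
  shows "(\<forall>n\<ge>1.
      (\<lambda>j::nat. (of_nat j - 1) * of_nat j ^ (n - 1) * q powi (int j - 2)) summable_on {1..} \<and>
      in_q (F21 n) =
        (1 - q) ^ (n + 1) *
        (\<Sum>\<^sub>\<infinity>j\<in>{1::nat..}. (of_nat j - 1) * of_nat j ^ (n - 1) * q powi (int j - 2)) \<and>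
      (1 - q) ^ (n + 1) *
        (\<Sum>\<^sub>\<infinity>j\<in>{1::nat..}. (of_nat j - 1) * of_nat j ^ (n - 1) * q powi (int j - 2)) =
        1 / q * (in_q (eulerian_poly n) + (q - 1) * in_q (eulerian_poly (n - 1)))) \<and>
    egf (\<lambda>n. F21 (n + 1)) =
        fps_const ((1 - q)\<^sup>2) / (fps_exp (q - 1) - fps_const q)\<^sup>2 \<and>
    fps_const ((1 - q)\<^sup>2) / (fps_exp (q - 1) - fps_const q)\<^sup>2 =
        (egf eulerian_poly)\<^sup>2"
proof -
  define D where "D = fps_exp (q - 1) - fps_const q"
  have D: "fps_const ((1 - q)\<^sup>2) = (egf eulerian_poly)\<^sup>2 * D\<^sup>2"
    unfolding D_def power_mult_distrib[symmetric] egf_eulerian_poly_times by simp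
  \<comment> \<open>Division by \<open>D\<^sup>2\<close> undoes the product once
    \<open>D\<^sup>2\<close> is nonzero; otherwise \<open>(1 - q)\<^sup>2\<close> would
    vanish.\<close>
  moreover have "D\<^sup>2 \<noteq> 0"
  proof
    assume "D\<^sup>2 = 0"
    with D have "fps_const ((1 - q)\<^sup>2) = 0" by simp
    then show False using one_minus_q_nonzero by simp
  qed
  ultimately have square: "fps_const ((1 - q)\<^sup>2) / D\<^sup>2 = (egf eulerian_poly)\<^sup>2"
    by simp
  have "(\<lambda>j::nat. (of_nat j - 1) * of_nat j ^ (n - 1) * q powi (int j - 2)) summable_on {1..} \<and>
      in_q (F21 n) =
        (1 - q) ^ (n + 1) *
        (\<Sum>\<^sub>\<infinity>j\<in>{1::nat..}. (of_nat j - 1) * of_nat j ^ (n - 1) * q powi (int j - 2)) \<and>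
      (1 - q) ^ (n + 1) *
        (\<Sum>\<^sub>\<infinity>j\<in>{1::nat..}. (of_nat j - 1) * of_nat j ^ (n - 1) * q powi (int j - 2)) =
        1 / q * (in_q (eulerian_poly n) + (q - 1) * in_q (eulerian_poly (n - 1)))"
    if "n \<ge> 1" for n
  proof -
    from that obtain m where n: "n = Suc m" by (cases n) auto
    \<comment> \<open>Laurent series form a field, so \<open>q\<close> may be multiplied in and
      divided out again.\<close>
    have "in_q (F21 (Suc m)) = 1 / q * (q * in_q (F21 (Suc m)))"
      by (simp only: times_divide_eq_left mult_1_left nonzero_mult_div_cancel_left[OF fls_X_nonzero])
    then have "in_q (F21 n) = 1 / q * (in_q (eulerian_poly n) + (q - 1) * in_q (eulerian_poly (n - 1)))"
      unfolding q_times_in_q_F21 n by simp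
    then show ?thesis
      using has_sum_flatten_series[of m] in_q_F21[of m]
      by (simp add: n infsumI has_sum_imp_summable)
  qed
  then show ?thesis
    using square egf_F21_eq_square unfolding D_def by simp
qed

end
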